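(* (Bilinearization and Casoratian solutions of A2.) Let $g_3(s)=s^3+\alpha_2s^2$ and $G_3(s,r)=g_3(s)-g_3(r)$, with $\alpha_2,c_1,c_2$ arbitrary constants and $c_3=\alpha_2/3$. Let $p,q,a$ be pairwise distinct parameters and put $$P=-G_3(-p,-a),\quad Q=-G_3(-q,-a),\quad p_a=\frac{-G_3(-p,-a)}{p-a},\quad q_a=\frac{-G_3(-q,-a)}{q-a}.$$ Consider the A2 lattice system $$A_1:=\widetilde xz-\widetilde y-x=0,\qquad A_2:=\widehat xz-\widehat y-x=0,\qquad A_3:=x\,\widehat{\widetilde z}-y-\frac{P\widetilde x-Q\widehat x}{\widetilde z-\widehat z}=0,$$ which has the background solution $$x_a=(p-a)^{-n}(q-a)^{-m}c_1,\qquad z_0=(c_3-p)n+(c_3-q)m+c_2,\qquad y_a=x_a(z_0+a-c_3).$$ (i) By the dependent variable transformation $$x=x_a\frac{\underline f}{f},\qquad z=z_0+\frac gf,\qquad y=y_a\frac{\underline f}{f}+x_a\frac{\underline g}{f},$$ A2 is bilinearized into $$\mathcal A_1:=\widetilde{\underline f}(g+pf)-(p-a)\underline f\,\widetilde f-f(a\widetilde{\underline f}+\widetilde{\underline g})=0,$$ $$\mathcal A_2:=\widehat{\underline f}(g+qf)-(q-a)\underline f\,\widehat f-f(a\widehat{\underline f}+\widehat{\underline g})=0,$$ $$\mathcal A_3:=\widetilde f\,\widehat g-\widehat f\,\widetilde g+(p-q)(\widetilde f\,\widehat f-f\,\widehat{\widetilde f})=0,$$ $$\mathcal A_4:=(p-q)\big[((p+q+a-\alpha_2)\underline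 f+\underline g)\widehat{\widetilde f}-\widehat{\widetilde g}\,\underline f\big]-p_a\widehat f\,\widetilde{\underline f}+q_a\widetilde f\,\widehat{\underline f}=0,$$ the connection being $$A_1=\frac{\widetilde x_a\mathcal A_1}{f\widetilde f},\qquad A_2=\frac{\widehat x_a\mathcal A_2}{f\widehat f},\qquad A_3=x_a\frac{\mathcal A_3\mathcal A_4+(p-q)f\,\widehat{\widetilde f}\,\mathcal A_4+(p_a\widehat f\,\widetilde{\underline f}-q_a\widetilde f\,\widehat{\underline f})\mathcal A_3}{(p-q)f\,\widetilde f\,\widehat f\,\widehat{\widetilde f}\,(\widetilde z-\widehat z)}.$$ (ii) Multisoliton solutions of the bilinear equations $\mathcal A_1=\mathcal A_2=\mathcal A_3=\mathcal A_4=0$ are given by the Casoratians $f=|0,1,\dots,N-1|$, $g=|0,1,\dots,N-2,N|$ composed of $$\psi_j(l)=\sum_{s=0}^2(-\omega_s(k_j))^l(p-\omega_s(k_j))^n(q-\omega_s(k_j))^m(a-\omega_s(k_j))^\alpha(b-\omega_s(k_j))^\beta\varrho_{j,s}^{(0)},\qquad j=1,\dots,N,$$ where $\varrho_{j,s}^{(0)}$ are constants, $\omega_0(k_j)=k_j$, and $\omega_1(k_j),\omega_2(k_j)$ are the roots of $g_3(\omega(k_j))=g_3(k_j)$.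
   Context: All functions depend on the integer variables $n,m$ and, for $f,g$, also on $\alpha$ (and $\beta$). For a function $u$: $\widetilde u$ denotes the shift $n\to n+1$, $\widehat u$ the shift $m\to m+1$, $\underline u$ the backward shift $\alpha\to\alpha-1$; combined decorations denote combined shifts. For the column vector $\psi(l)=(\psi_1(l),\dots,\psi_N(l))^T$, the Casoratian $|l_1,l_2,\dots,l_N|$ is the $N\times N$ determinant $\det(\psi(l_1),\psi(l_2),\dots,\psi(l_N))$. $b$ is a lattice parameter associated with the variable $\beta$. Denominators are assumed nonzero.
   Formalization: The roots ω_1(k_j), ω_2(k_j) are taken from g_3(−ω(k_j)) = g_3(−k_j) instead of the printed g_3(ω(k_j)) = g_3(k_j); with the printed sign the fourth bilinear equation fails in general when α_2 ≠ 0 (e.g. N=1, α_2=−7/3, roots 1, 2, −2/3). *)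

theory Defs
  imports Complex_Main "Jordan_Normal_Form.Determinant"
begin

(* A lattice function has the arguments (n, m, \<alpha>, \<beta>); x, y, z inherit the
   dependence on \<alpha> and \<beta> from f and g. *)
type_synonym lat = "int \<times> int \<times> int \<times> int \<Rightarrow> complex"

definition til :: "lat \<Rightarrow> lat" where
  "til u = (\<lambda>(n, m, \<alpha>, \<beta>). u (n + 1, m, \<alpha>, \<beta>))"

definition hat :: "lat \<Rightarrow> lat" where
  "hat u = (\<lambda>(n, m, \<alpha>, \<beta>). u (n, m + 1, \<alpha>, \<beta>))"

definition und :: "lat \<Rightarrow> lat" where
  "und u = (\<lambda>(n, m, \<alpha>, \<beta>). u (n, m, \<alpha> - 1, \<beta>))"

definition g3 :: "complex \<Rightarrow> complex \<Rightarrow> complex" where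
  "g3 \<alpha>2 s = s ^ 3 + \<alpha>2 * s ^ 2"

definition G3 :: "complex \<Rightarrow> complex \<Rightarrow> complex \<Rightarrow> complex" where
  "G3 \<alpha>2 s r = g3 \<alpha>2 s - g3 \<alpha>2 r"

(* coefP \<alpha>2 a p and coefP \<alpha>2 a q are P and Q; coefp \<alpha>2 a p and coefp \<alpha>2 a q
   are p_a and q_a. *)
definition coefP :: "complex \<Rightarrow> complex \<Rightarrow> complex \<Rightarrow> complex" where
  "coefP \<alpha>2 a p = - G3 \<alpha>2 (- p) (- a)"

definition coefp :: "complex \<Rightarrow> complex \<Rightarrow> complex \<Rightarrow> complex" where
  "coefp \<alpha>2 a p = - G3 \<alpha>2 (- p) (- a) / (p - a)"


definition A1 :: "lat \<Rightarrow> lat \<Rightarrow> lat \<Rightarrow> lat" where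
  "A1 x y z = (\<lambda>\<xi>. til x \<xi> * z \<xi> - til y \<xi> - x \<xi>)"

definition A2 :: "lat \<Rightarrow> lat \<Rightarrow> lat \<Rightarrow> lat" where
  "A2 x y z = (\<lambda>\<xi>. hat x \<xi> * z \<xi> - hat y \<xi> - x \<xi>)"

definition A3 :: "complex \<Rightarrow> complex \<Rightarrow> lat \<Rightarrow> lat \<Rightarrow> lat \<Rightarrow> lat" where
  "A3 P Q x y z = (\<lambda>\<xi>. x \<xi> * hat (til z) \<xi> - y \<xi>
     - (P * til x \<xi> - Q * hat x \<xi>) / (til z \<xi> - hat z \<xi>))"

(* The first conjunct keeps the quotient in A3 a genuine one (division by 0 is total). *)
definition solves_A2 :: "complex \<Rightarrow> complex \<Rightarrow> lat \<Rightarrow> lat \<Rightarrow> lat \<Rightarrow> bool" where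
  "solves_A2 P Q x y z \<longleftrightarrow> (\<forall>\<xi>. til z \<xi> \<noteq> hat z \<xi> \<and>
     A1 x y z \<xi> = 0 \<and> A2 x y z \<xi> = 0 \<and> A3 P Q x y z \<xi> = 0)"


definition x_bg :: "complex \<Rightarrow> complex \<Rightarrow> complex \<Rightarrow> complex \<Rightarrow> lat" where
  "x_bg p q a c1 = (\<lambda>(n, m, \<alpha>, \<beta>). (p - a) powi (- n) * (q - a) powi (- m) * c1)"

definition z_bg :: "complex \<Rightarrow> complex \<Rightarrow> complex \<Rightarrow> complex \<Rightarrow> lat" where
  "z_bg p q c3 c2 = (\<lambda>(n, m, \<alpha>, \<beta>). (c3 - p) * of_int n + (c3 - q) * of_int m + c2)"

definition y_bg :: "complex \<Rightarrow> complex \<Rightarrow> lat \<Rightarrow> lat \<Rightarrow> lat" where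
  "y_bg a c3 xa z0 = (\<lambda>\<xi>. xa \<xi> * (z0 \<xi> + a - c3))"


definition x_tr :: "lat \<Rightarrow> lat \<Rightarrow> lat" where
  "x_tr xa f = (\<lambda>\<xi>. xa \<xi> * (und f \<xi> / f \<xi>))"

definition z_tr :: "lat \<Rightarrow> lat \<Rightarrow> lat \<Rightarrow> lat" where
  "z_tr z0 f g = (\<lambda>\<xi>. z0 \<xi> + g \<xi> / f \<xi>)"

definition y_tr :: "lat \<Rightarrow> lat \<Rightarrow> lat \<Rightarrow> lat \<Rightarrow> lat" where
  "y_tr xa ya f g = (\<lambda>\<xi>. ya \<xi> * (und f \<xi> / f \<xi>) + xa \<xi> * (und g \<xi> / f \<xi>))"


definition B1 :: "complex \<Rightarrow> complex \<Rightarrow> lat \<Rightarrow> lat \<Rightarrow> lat" where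
  "B1 p a f g = (\<lambda>\<xi>. til (und f) \<xi> * (g \<xi> + p * f \<xi>) - (p - a) * und f \<xi> * til f \<xi>
     - f \<xi> * (a * til (und f) \<xi> + til (und g) \<xi>))"

definition B2 :: "complex \<Rightarrow> complex \<Rightarrow> lat \<Rightarrow> lat \<Rightarrow> lat" where
  "B2 q a f g = (\<lambda>\<xi>. hat (und f) \<xi> * (g \<xi> + q * f \<xi>) - (q - a) * und f \<xi> * hat f \<xi>
     - f \<xi> * (a * hat (und f) \<xi> + hat (und g) \<xi>))"

definition B3 :: "complex \<Rightarrow> complex \<Rightarrow> lat \<Rightarrow> lat \<Rightarrow> lat" where
  "B3 p q f g = (\<lambda>\<xi>. til f \<xi> * hat g \<xi> - hat f \<xi> * til g \<xi>
     + (p - q) * (til f \<xi> * hat f \<xi> - f \<xi> * hat (til f) \<xi>))"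

definition B4 :: "complex \<Rightarrow> complex \<Rightarrow> complex \<Rightarrow> complex \<Rightarrow> lat \<Rightarrow> lat \<Rightarrow> lat" where
  "B4 \<alpha>2 p q a f g = (\<lambda>\<xi>.
     (p - q) * (((p + q + a - \<alpha>2) * und f \<xi> + und g \<xi>) * hat (til f) \<xi>
                - hat (til g) \<xi> * und f \<xi>)
     - coefp \<alpha>2 a p * hat f \<xi> * til (und f) \<xi> + coefp \<alpha>2 a q * til f \<xi> * hat (und f) \<xi>)"

definition solves_bilinear ::
    "complex \<Rightarrow> complex \<Rightarrow> complex \<Rightarrow> complex \<Rightarrow> lat \<Rightarrow> lat \<Rightarrow> bool" where
  "solves_bilinear \<alpha>2 p q a f g \<longleftrightarrow> (\<forall>\<xi>. B1 p a f g \<xi> = 0 \<and> B2 q a f g \<xi> = 0 \<and>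
     B3 p q f g \<xi> = 0 \<and> B4 \<alpha>2 p q a f g \<xi> = 0)"


(* The Casoratian |l_1, ..., l_N| for ls = [l_1, ..., l_N]; the components \<psi> j of the
   column vector are numbered by j = 1, ..., N, while matrix indices start at 0. *)
definition casoratian :: "(nat \<Rightarrow> nat \<Rightarrow> lat) \<Rightarrow> nat list \<Rightarrow> lat" where
  "casoratian \<psi> ls = (\<lambda>\<xi>. det (mat (length ls) (length ls) (\<lambda>(i, c). \<psi> (Suc i) (ls ! c) \<xi>)))"

(* \<omega> 0 k = k, \<omega> 1 k, \<omega> 2 k are the three roots, counted with multiplicity, of
   g_3(-\<omega>) = g_3(-k). The source prints g_3(\<omega>) = g_3(k). With the factors (-\<omega>)^l,
   (p - \<omega>)^n, ... of the entries \<psi>_j and the coefficients -G_3(-p,-a), the variable of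
   g_3 is -\<omega>; with the printed sign B4 = 0 fails whenever \<alpha>2 \<noteq> 0 (for instance N = 1,
   \<alpha>2 = -7/3, roots 1, 2, -2/3 with constants 1, 1, 0 give B4 = -14 (p - q) at
   (n, m, \<alpha>, \<beta>) = (0, 0, 1, 0)). The two conventions agree for \<alpha>2 = 0. *)
definition omega_roots :: "complex \<Rightarrow> (nat \<Rightarrow> complex \<Rightarrow> complex) \<Rightarrow> complex \<Rightarrow> bool" where
  "omega_roots \<alpha>2 \<omega> k \<longleftrightarrow> \<omega> 0 k = k \<and>
     (\<forall>s. g3 \<alpha>2 (- s) - g3 \<alpha>2 (- k) = - ((s - \<omega> 0 k) * (s - \<omega> 1 k) * (s - \<omega> 2 k)))"

definition psi :: "complex \<Rightarrow> complex \<Rightarrow> complex \<Rightarrow> complex \<Rightarrow> (nat \<Rightarrow> complex \<Rightarrow> complex) \<Rightarrow>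
    (nat \<Rightarrow> complex) \<Rightarrow> (nat \<Rightarrow> nat \<Rightarrow> complex) \<Rightarrow> nat \<Rightarrow> nat \<Rightarrow> lat" where
  "psi p q a b \<omega> k \<rho> j l = (\<lambda>(n, m, \<alpha>, \<beta>). \<Sum>s = 0..2.
     (- \<omega> s (k j)) ^ l * (p - \<omega> s (k j)) powi n * (q - \<omega> s (k j)) powi m
       * (a - \<omega> s (k j)) powi \<alpha> * (b - \<omega> s (k j)) powi \<beta> * \<rho> j s)"

end

(* Let T act as the index shift l -> l + 1. Raising n, m or \<alpha> multiplies psi(l) = T^l by
   T + p, T + q or T + a, so each f is the determinant of R T^0, ..., R T^(N-1) for a product R
   of such factors. The bilinear equations are instances of Cramer's rule: a functional that
   is a combination of the N rows gives 0 when it borders the N x (N+1) matrix of columns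
   R T^0, ..., R T^N. For B1, B2, B3 the functional pairs (T + p) T^c with the columns
   (T + q) T^0, ..., (T + q) T^(N-2). For B4 it pairs (g_3(T) - g_3(-a)) T^c with the columns
   (T + p)(T + q)(T + a) T^i, i <= N - 2; it is a combination of the rows because g_3(T) acts on
   row j as the scalar g_3(-k_j), and its evaluation terms at T = -p and T = -q produce the
   coefficients p_a and q_a. *)
theory Submission
  imports Defs
begin

section \<open>Determinants given by their columns\<close>

text \<open>The column index comes first, so that \<open>u(m := v)\<close> exchanges a whole
  column.\<close>

definition cdet :: "nat \<Rightarrow> (nat \<Rightarrow> nat \<Rightarrow> complex) \<Rightarrow> complex" where
  "cdet n u = det (mat n n (\<lambda>(i, c). u c i))"

text \<open>The Casoratian g for N = m + 1, with column indices 0, ..., m - 1, m + 1. Counting by m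
  avoids the subtraction N - 1.\<close>

definition gdet :: "nat \<Rightarrow> (nat \<Rightarrow> nat \<Rightarrow> complex) \<Rightarrow> complex" where
  "gdet m u = cdet (Suc m) (u(m := u (Suc m)))"

lemma cdet_cong: "(\<And>c i. c < n \<Longrightarrow> i < n \<Longrightarrow> u c i = v c i) \<Longrightarrow> cdet n u = cdet n v"
  unfolding cdet_def by (intro arg_cong[where f = det] eq_matI) auto

text \<open>Expansion along the last column: the cofactors delete that column, so one
  \<open>\<kappa>\<close> serves every \<open>v\<close>.\<close>

lemma cdet_last_column_linear:
  "\<exists>\<kappa>. \<forall>v. cdet (Suc m) (u(m := v)) = (\<Sum>i\<le>m. v i * \<kappa> i)"
proof -
  define A where "A v = mat (Suc m) (Suc m) (\<lambda>(i, c). (u(m := v)) c i)" for v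
  have A: "A v \<in> carrier_mat (Suc m) (Suc m)" for v by (simp add: A_def)
  have del: "mat_delete (A v) i m = mat_delete (A (\<lambda>_. 0)) i m" if "i < Suc m" for v i
    by (rule eq_matI) (auto simp: mat_delete_def A_def)
  have "cdet (Suc m) (u(m := v)) = (\<Sum>i\<le>m. v i * cofactor (A (\<lambda>_. 0)) i m)" for v
  proof -
    have "cdet (Suc m) (u(m := v)) = (\<Sum>i<Suc m. A v $$ (i, m) * cofactor (A v) i m)"
      unfolding cdet_def A_def[symmetric] by (rule laplace_expansion_column[OF A]) simp
    also have "\<dots> = (\<Sum>i\<le>m. v i * cofactor (A (\<lambda>_. 0)) i m)"
      unfolding lessThan_Suc_atMost
      by (intro sum.cong refl) (simp add: cofactor_def del[where v = v], simp add: A_def)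
    finally show ?thesis .
  qed
  then show ?thesis by (intro exI allI)
qed

lemma cdet_equal_columns:
  assumes "c < m"
  shows "cdet (Suc m) (u(m := u c)) = 0"
  unfolding cdet_def
  by (rule det_identical_columns[of _ "Suc m" c m]) (use assms in \<open>auto intro!: eq_vecI\<close>)

text \<open>Right multiplication by the change of basis from the powers of T to the
  polynomials (T + q) T^c together with the constant 1.\<close>
lemma cdet_shift_columns:
  assumes u': "\<And>c i. c < m \<Longrightarrow> i < Suc m \<Longrightarrow> u' c i = u (Suc c) i + q * u c i"
  shows "cdet (Suc m) (u'(m := u 0)) = (- 1) ^ m * cdet (Suc m) u"
proof -
  define A where "A = mat (Suc m) (Suc m) (\<lambda>(i, c). u c i)"
  \<comment> \<open>In coordinates with respect to the powers of T, column c < m is T^c (T + q) and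
    the last column is the constant 1.\<close>
  define U where "U = mat (Suc m) (Suc m) (\<lambda>(k, c). if c = m then of_bool (k = 0)
     else of_bool (k = Suc c) + q * of_bool (k = c))"
  \<comment> \<open>Deleting row 0 and the last column moves the ones onto the diagonal and the q
    above it. Hence the corner cofactor is just its sign (-1)^m.\<close>
  define V where "V = mat_delete U 0 m"
  have A: "A \<in> carrier_mat (Suc m) (Suc m)" and U: "U \<in> carrier_mat (Suc m) (Suc m)"
    by (simp_all add: A_def U_def)
  have V: "V \<in> carrier_mat m m" by (simp add: V_def U_def mat_delete_def)
  have "det V = prod_list (diag_mat V)"
    by (rule det_upper_triangular[OF _ V])
      (auto simp: V_def U_def mat_delete_def upper_triangular_def)
  also have "diag_mat V = map (\<lambda>_. 1) [0..<m]"
    by (auto simp: V_def U_def mat_delete_def diag_mat_def)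
  finally have detV: "det V = 1" by (simp add: map_replicate_const)
  have "det U = (\<Sum>k<Suc m. U $$ (k, m) * cofactor U k m)"
    by (rule laplace_expansion_column[OF U]) simp
  also have "\<dots> = (\<Sum>k<Suc m. if k = 0 then (- 1) ^ m else 0)"
    by (intro sum.cong) (auto simp: U_def cofactor_def detV[unfolded V_def U_def])
  finally have detU: "det U = (- 1) ^ m" by simp
  have AU: "A * U = mat (Suc m) (Suc m) (\<lambda>(i, c). (u'(m := u 0)) c i)" (is "_ = ?B")
  proof (rule eq_matI)
    fix i c assume "i < dim_row ?B" "c < dim_col ?B"
    then have ic: "i < Suc m" "c < Suc m" by auto
    have "(A * U) $$ (i, c) = (\<Sum>k<Suc m. u k i * U $$ (k, c))"
      using ic by (simp add: A_def U_def scalar_prod_def atLeast0LessThan)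
    also have "\<dots> = (u'(m := u 0)) c i"
    proof (cases "c = m")
      case True
      then have "(\<Sum>k<Suc m. u k i * U $$ (k, c)) = (\<Sum>k<Suc m. if k = 0 then u k i else 0)"
        by (intro sum.cong) (auto simp: U_def)
      then show ?thesis using True by simp
    next
      case False
      then have "(\<Sum>k<Suc m. u k i * U $$ (k, c)) =
         (\<Sum>k<Suc m. (if k = Suc c then u k i else 0) + (if k = c then q * u k i else 0))"
        using ic by (intro sum.cong) (auto simp: U_def)
      also have "\<dots> = u (Suc c) i + q * u c i"
        using ic False by (simp only: sum.distrib) (simp add: sum.delta del: sum.lessThan_Suc)
      finally show ?thesis using ic False u' by simp
    qed
    finally show "(A * U) $$ (i, c) = ?B $$ (i, c)" using ic by simp
  qed (auto simp: A_def U_def)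
  have "cdet (Suc m) (u'(m := u 0)) = det A * det U"
    unfolding cdet_def AU[symmetric] by (rule det_mult[OF A U])
  then show ?thesis by (simp add: detU cdet_def A_def)
qed

section \<open>Bordered determinants and linear functionals\<close>

text \<open>Used with n + 1 columns: the bottom row is a linear functional on polynomials in T of
  degree at most n, listed by its values on T^0, ..., T^n.\<close>

definition border :: "nat \<Rightarrow> (nat \<Rightarrow> nat \<Rightarrow> complex) \<Rightarrow> (nat \<Rightarrow> complex) \<Rightarrow> nat \<Rightarrow> nat \<Rightarrow> complex" where
  "border n u l = (\<lambda>c i. if i < n then u c i else l c)"

text \<open>The cofactors of the bottom row do not involve \<open>l\<close>. This allows a
  functional to be split into simple summands.\<close>

lemma border_linear:
  "\<exists>K. \<forall>l. cdet (Suc n) (border n u l) = (\<Sum>c\<le>n. l c * K c)"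
proof -
  define A where "A l = mat (Suc n) (Suc n) (\<lambda>(i, c). border n u l c i)" for l
  have A: "A l \<in> carrier_mat (Suc n) (Suc n)" for l by (simp add: A_def)
  have del: "mat_delete (A l) n c = mat_delete (A (\<lambda>_. 0)) n c" if "c < Suc n" for l c
    by (rule eq_matI) (auto simp: mat_delete_def A_def border_def)
  have "cdet (Suc n) (border n u l) = (\<Sum>c\<le>n. l c * cofactor (A (\<lambda>_. 0)) n c)" for l
  proof -
    have "cdet (Suc n) (border n u l) = (\<Sum>c<Suc n. A l $$ (n, c) * cofactor (A l) n c)"
      unfolding cdet_def A_def[symmetric] by (rule laplace_expansion_row[OF A]) simp
    also have "\<dots> = (\<Sum>c\<le>n. l c * cofactor (A (\<lambda>_. 0)) n c)"
      unfolding lessThan_Suc_atMost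
      by (intro sum.cong refl) (simp add: cofactor_def del[where l = l], simp add: A_def border_def)
    finally show ?thesis .
  qed
  then show ?thesis by (intro exI allI)
qed

lemma border_unit:
  assumes "c \<le> n"
  shows "cdet (Suc n) (border n u (\<lambda>j. of_bool (j = c)))
    = (- 1) ^ (n + c) * cdet n (\<lambda>j. u (if j < c then j else Suc j))"
proof -
  define A where "A = mat (Suc n) (Suc n) (\<lambda>(i, j). border n u (\<lambda>j. of_bool (j = c)) j i)"
  have A: "A \<in> carrier_mat (Suc n) (Suc n)" by (simp add: A_def)
  have del: "mat_delete A n c = mat n n (\<lambda>(i, j). u (if j < c then j else Suc j) i)"
    using assms by (intro eq_matI) (auto simp: mat_delete_def A_def border_def)
  have "cdet (Suc n) (border n u (\<lambda>j. of_bool (j = c))) = (\<Sum>j<Suc n. A $$ (n, j) * cofactor A n j)"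
    unfolding cdet_def A_def[symmetric] by (rule laplace_expansion_row[OF A]) simp
  also have "\<dots> = (\<Sum>j<Suc n. if j = c then cofactor A n c else 0)"
    by (intro sum.cong) (auto simp: A_def border_def)
  also have "\<dots> = cofactor A n c" using assms by (simp del: sum.lessThan_Suc)
  finally show ?thesis by (simp add: cofactor_def del cdet_def)
qed

text \<open>The border is evaluation at T = -q, which kills every T^c (T + q) and sends 1 to 1. In
  the basis of \<open>cdet_shift_columns\<close> it becomes a unit vector, and deleting its column
  leaves the matrix shifted by T + q.\<close>

lemma border_geometric:
  assumes u': "\<And>c i. c < n \<Longrightarrow> i < n \<Longrightarrow> u' c i = u (Suc c) i + q * u c i"
  shows "cdet (Suc n) (border n u (\<lambda>c. (- q) ^ c)) = (- 1) ^ n * cdet n u'"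
proof -
  have "(- 1) ^ n * cdet (Suc n) (border n u (\<lambda>c. (- q) ^ c))
      = cdet (Suc n) ((border n u' (\<lambda>_. 0))(n := border n u (\<lambda>c. (- q) ^ c) 0))"
    by (rule cdet_shift_columns[where q = q, symmetric]) (use u' in \<open>auto simp: border_def\<close>)
  also have "\<dots> = cdet (Suc n) (border n (u'(n := u 0)) (\<lambda>j. of_bool (j = n)))"
    by (rule cdet_cong) (auto simp: border_def)
  also have "\<dots> = cdet n u'"
    by (subst border_unit) (auto intro: cdet_cong)
  finally have "(- 1) ^ n * ((- 1) ^ n * cdet (Suc n) (border n u (\<lambda>c. (- q) ^ c)))
      = (- 1) ^ n * cdet n u'" by simp
  then show ?thesis by (simp flip: mult.assoc power_add)
qed

lemma border_dependent:
  assumes l: "\<And>c. c \<le> n \<Longrightarrow> l c = (\<Sum>i<n. \<mu> i * u c i)"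
  shows "cdet (Suc n) (border n u l) = 0"
proof -
  define A where "A = mat (Suc n) (Suc n) (\<lambda>(i, c). border n u l c i)"
  have A: "A \<in> carrier_mat (Suc n) (Suc n)" by (simp add: A_def)
  \<comment> \<open>The row relation: the combination of the upper rows minus the bottom row. The
    entry -1 keeps the vector nonzero.\<close>
  define v where "v = vec (Suc n) (\<lambda>i. if i < n then \<mu> i else - 1)"
  have "A\<^sup>T *\<^sub>v v = 0\<^sub>v (Suc n)"
    by (rule eq_vecI) (auto simp: A_def v_def scalar_prod_def border_def l atLeast0LessThan mult.commute)
  moreover have "v $ n = - 1" by (simp add: v_def)
  then have "v \<noteq> 0\<^sub>v (Suc n)" by auto
  moreover have "v \<in> carrier_vec (Suc n)" by (simp add: v_def)
  ultimately have "det A\<^sup>T = 0"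
    by (subst det_0_iff_vec_prod_zero[of _ "Suc n"]) (auto simp: A)
  then show ?thesis using det_transpose[OF A] by (simp add: cdet_def A_def)
qed

text \<open>The border is a combination of the rows above it, so the bordered determinant vanishes.
  Splitting the border into two unit vectors and the evaluations at -q and -p turns this into a
  relation between minors.\<close>

lemma border_pairing:
  fixes A B C D :: complex
  assumes l: "\<And>c. c \<le> Suc m \<Longrightarrow> (\<Sum>i\<le>m. \<mu> i * u c i)
      = A * of_bool (c = m) + B * of_bool (c = Suc m) + C * (- q) ^ c + D * (- p) ^ c"
    and uq: "\<And>c i. c < Suc m \<Longrightarrow> i < Suc m \<Longrightarrow> uq c i = u (Suc c) i + q * u c i"
    and up: "\<And>c i. c < Suc m \<Longrightarrow> i < Suc m \<Longrightarrow> up c i = u (Suc c) i + p * u c i"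
  shows "B * cdet (Suc m) u
    = A * gdet m u + (- 1) ^ m * (C * cdet (Suc m) uq + D * cdet (Suc m) up)"
proof -
  define W where "W l = cdet (Suc (Suc m)) (border (Suc m) u l)" for l
  define l where "l c = A * of_bool (c = m) + B * of_bool (c = Suc m) + C * (- q) ^ c + D * (- p) ^ c" for c
  obtain K where K: "\<And>l. W l = (\<Sum>c\<le>Suc m. l c * K c)"
    unfolding W_def using border_linear by blast
  have "W l = 0"
    unfolding W_def
    by (rule border_dependent[where \<mu> = \<mu>]) (use assms(1) in \<open>auto simp: l_def lessThan_Suc_atMost\<close>)
  moreover have "W l = A * W (\<lambda>c. of_bool (c = m)) + B * W (\<lambda>c. of_bool (c = Suc m))
      + C * W (\<lambda>c. (- q) ^ c) + D * W (\<lambda>c. (- p) ^ c)"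
    unfolding K sum_distrib_left sum.distrib[symmetric] l_def
    by (intro sum.cong) (auto simp: algebra_simps)
  \<comment> \<open>Deleting column m from 0, ..., m + 1 leaves the columns of \<open>gdet\<close>,
    with the odd sign (-1)^(2m + 1).\<close>
  moreover have "W (\<lambda>c. of_bool (c = m)) = - gdet m u"
    unfolding W_def gdet_def by (subst border_unit) (auto simp flip: mult_2 intro!: cdet_cong)
  moreover have "W (\<lambda>c. of_bool (c = Suc m)) = cdet (Suc m) u"
    unfolding W_def by (subst border_unit) (auto simp flip: mult_2 intro!: cdet_cong)
  moreover have "W (\<lambda>c. (- q) ^ c) = (- 1) ^ Suc m * cdet (Suc m) uq"
    unfolding W_def by (rule border_geometric) (fact uq)
  moreover have "W (\<lambda>c. (- p) ^ c) = (- 1) ^ Suc m * cdet (Suc m) up"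
    unfolding W_def by (rule border_geometric) (fact up)
  ultimately show ?thesis by (simp add: algebra_simps)
qed

text \<open>A column with c < m would occur twice and gives 0; c = m restores the determinant
  itself; c = m + 1 is \<open>gdet\<close>.\<close>

lemma cdet_column_pairing:
  obtains \<kappa> where "\<And>v. cdet (Suc m) (u(m := v)) = (\<Sum>i\<le>m. \<kappa> i * v i)"
    and "\<And>c. c \<le> Suc m \<Longrightarrow> (\<Sum>i\<le>m. \<kappa> i * u c i)
      = cdet (Suc m) u * of_bool (c = m) + gdet m u * of_bool (c = Suc m)"
proof -
  obtain \<kappa> where \<kappa>: "\<And>v. cdet (Suc m) (u(m := v)) = (\<Sum>i\<le>m. \<kappa> i * v i)"
    using cdet_last_column_linear[of m u] by (auto simp: mult.commute)
  have "(\<Sum>i\<le>m. \<kappa> i * u c i)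
      = cdet (Suc m) u * of_bool (c = m) + gdet m u * of_bool (c = Suc m)" if "c \<le> Suc m" for c
    unfolding \<kappa>[symmetric] using that cdet_equal_columns[of c m u]
    by (cases "c < m"; cases "c = m") (auto simp: le_Suc_eq gdet_def)
  with \<kappa> show thesis by (rule that)
qed

section \<open>Bilinear identities for Casoratian-type determinants\<close>

text \<open>The common source of \<open>B1\<close>, \<open>B2\<close> and \<open>B3\<close>, which
  differ in the two shifts chosen among p, q and a. The last-column functional of the q-shifted
  matrix is paired with the p-shifted columns.\<close>

lemma casorati_two_shifts:
  assumes up: "\<And>c i. i < Suc m \<Longrightarrow> up c i = u (Suc c) i + p * u c i"
    and uq: "\<And>c i. i < Suc m \<Longrightarrow> uq c i = u (Suc c) i + q * u c i"
    and upq: "\<And>c i. i < Suc m \<Longrightarrow> upq c i = up (Suc c) i + q * up c i"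
  shows "cdet (Suc m) up * gdet m uq - cdet (Suc m) uq * gdet m up
    + (p - q) * (cdet (Suc m) up * cdet (Suc m) uq - cdet (Suc m) u * cdet (Suc m) upq) = 0"
proof -
  obtain \<kappa> where \<kappa>: "\<And>v. cdet (Suc m) (uq(m := v)) = (\<Sum>i\<le>m. \<kappa> i * v i)"
    and \<kappa>q: "\<And>c. c \<le> Suc m \<Longrightarrow> (\<Sum>i\<le>m. \<kappa> i * uq c i)
      = cdet (Suc m) uq * of_bool (c = m) + gdet m uq * of_bool (c = Suc m)"
    by (rule cdet_column_pairing[of m uq]) blast
  define w where "w c = (\<Sum>i\<le>m. \<kappa> i * u c i)" for c
  have w0: "w 0 = (- 1) ^ m * cdet (Suc m) u"
    unfolding w_def \<kappa>[symmetric] by (rule cdet_shift_columns[where q = q]) (rule uq)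
  have q: "(\<Sum>i\<le>m. \<kappa> i * uq c i) = w (Suc c) + q * w c" for c
    unfolding w_def sum_distrib_left sum.distrib[symmetric]
    by (intro sum.cong) (auto simp: uq algebra_simps)
  have p: "(\<Sum>i\<le>m. \<kappa> i * up c i) = w (Suc c) + p * w c" for c
    unfolding w_def sum_distrib_left sum.distrib[symmetric]
    by (intro sum.cong) (auto simp: up algebra_simps)
  \<comment> \<open>The functional kills (T + q) T^c for c < m, so \<open>w\<close> is geometric
    with ratio -q up to index m. The first deviation occurs at m + 1.\<close>
  have w: "w c = (- q) ^ c * w 0 + cdet (Suc m) uq * of_bool (c = Suc m)" if "c \<le> Suc m" for c
    using that
  proof (induction c)
    case (Suc c)
    then show ?case using q[of c] \<kappa>q[of c] by (auto simp: algebra_simps)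
  qed simp
  \<comment> \<open>Only the evaluation at -q occurs here; the second evaluation slot of
    \<open>border_pairing\<close> gets coefficient 0.\<close>
  have "(gdet m uq + (p - q) * cdet (Suc m) uq) * cdet (Suc m) up = cdet (Suc m) uq * gdet m up
      + (- 1) ^ m * (((p - q) * w 0) * cdet (Suc m) upq + 0 * cdet (Suc m) upq)"
  proof (rule border_pairing)
    fix c assume c: "c \<le> Suc m"
    \<comment> \<open>This is T + p = (T + q) + (p - q): the first part is known from
      \<open>\<kappa>q\<close>, the second from \<open>w\<close>.\<close>
    have "w (Suc c) + p * w c = (\<Sum>i\<le>m. \<kappa> i * uq c i) + (p - q) * w c"
      by (simp add: q algebra_simps)
    then show "(\<Sum>i\<le>m. \<kappa> i * up c i) = cdet (Suc m) uq * of_bool (c = m)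
        + (gdet m uq + (p - q) * cdet (Suc m) uq) * of_bool (c = Suc m)
        + ((p - q) * w 0) * (- q) ^ c + 0 * (- q) ^ c"
      unfolding p \<kappa>q[OF c] w[OF c] by (simp add: algebra_simps)
  qed (auto simp: upq)
  also have "(- 1) ^ m * (((p - q) * w 0) * cdet (Suc m) upq + 0 * cdet (Suc m) upq)
      = (p - q) * cdet (Suc m) u * cdet (Suc m) upq"
    unfolding w0 by (cases "even m") (simp_all add: algebra_simps)
  finally show ?thesis by (simp add: algebra_simps)
qed

text \<open>The source of \<open>B4\<close>. Here \<open>\<gamma> i\<close> is the scalar by which
  g_3(T) acts on row i. The quotient of g_3(T) - g_3(-a) by T + a is a monic quadratic; modulo (T +
  p)(T + q) it has a linear remainder, whose values at -p and -q are the two polynomial coefficients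
  in the conclusion.\<close>

lemma casorati_cubic:
  assumes up: "\<And>c i. i < Suc m \<Longrightarrow> up c i = u (Suc c) i + p * u c i"
    and uq: "\<And>c i. i < Suc m \<Longrightarrow> uq c i = u (Suc c) i + q * u c i"
    and ua: "\<And>c i. i < Suc m \<Longrightarrow> ua c i = u (Suc c) i + a * u c i"
    and upa: "\<And>c i. i < Suc m \<Longrightarrow> upa c i = ua (Suc c) i + p * ua c i"
    and uqa: "\<And>c i. i < Suc m \<Longrightarrow> uqa c i = ua (Suc c) i + q * ua c i"
    and upqa: "\<And>c i. i < Suc m \<Longrightarrow> upqa c i = upa (Suc c) i + q * upa c i"
    and cubic: "\<And>c i. i < Suc m \<Longrightarrow> u (c + 3) i + \<alpha>2 * u (c + 2) i = \<gamma> i * u c i"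
  shows "(p - q) * (((p + q + a - \<alpha>2) * cdet (Suc m) u + gdet m u) * cdet (Suc m) upqa
      - gdet m upqa * cdet (Suc m) u)
    - (p ^ 2 + p * a + a ^ 2 - \<alpha>2 * (p + a)) * cdet (Suc m) uqa * cdet (Suc m) up
    + (q ^ 2 + q * a + a ^ 2 - \<alpha>2 * (q + a)) * cdet (Suc m) upa * cdet (Suc m) uq = 0"
proof -
  obtain \<kappa> where \<kappa>: "\<And>v. cdet (Suc m) (upqa(m := v)) = (\<Sum>i\<le>m. \<kappa> i * v i)"
    and \<kappa>q: "\<And>c. c \<le> Suc m \<Longrightarrow> (\<Sum>i\<le>m. \<kappa> i * upqa c i)
      = cdet (Suc m) upqa * of_bool (c = m) + gdet m upqa * of_bool (c = Suc m)"
    by (rule cdet_column_pairing[of m upqa]) blast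
  define w where "w c = (\<Sum>i\<le>m. \<kappa> i * ua c i)" for c
  define X where "X = (- 1) ^ m * cdet (Suc m) upa"
  define Y where "Y = (- 1) ^ m * cdet (Suc m) uqa"
  \<comment> \<open>Chosen so that g_3(T) - g_3(-a) = (T + a) ((T + p)(T + q) + e T + d).\<close>
  define d where "d = a ^ 2 - \<alpha>2 * a - p * q"
  define e where "e = \<alpha>2 - a - p - q"
  have "X = (\<Sum>i\<le>m. \<kappa> i * upa 0 i)"
    unfolding \<kappa>[symmetric] X_def by (rule cdet_shift_columns[where q = q, symmetric]) (rule upqa)
  also have "\<dots> = w (Suc 0) + p * w 0"
    unfolding w_def sum_distrib_left sum.distrib[symmetric]
    by (intro sum.cong) (auto simp: upa algebra_simps)
  finally have X: "X = w (Suc 0) + p * w 0" .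
  \<comment> \<open>The shifts commute, so \<open>upqa\<close> is also the p-shift of
    \<open>uqa\<close>.\<close>
  have "Y = (\<Sum>i\<le>m. \<kappa> i * uqa 0 i)"
    unfolding \<kappa>[symmetric] Y_def
    by (rule cdet_shift_columns[symmetric, where q = p]) (auto simp: upqa upa uqa algebra_simps)
  also have "\<dots> = w (Suc 0) + q * w 0"
    unfolding w_def sum_distrib_left sum.distrib[symmetric]
    by (intro sum.cong) (auto simp: uqa algebra_simps)
  finally have Y: "Y = w (Suc 0) + q * w 0" .
  have q: "(\<Sum>i\<le>m. \<kappa> i * upqa c i) = w (Suc (Suc c)) + (p + q) * w (Suc c) + p * q * w c" for c
    unfolding w_def sum_distrib_left sum.distrib[symmetric]
    by (intro sum.cong) (auto simp: upqa upa algebra_simps)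
  \<comment> \<open>Below index m + 2, \<open>w\<close> satisfies the recurrence with characteristic
    roots -p and -q, with \<open>X\<close> and \<open>Y\<close> as initial data. The factor p - q
    avoids a division.\<close>
  have w: "(p - q) * w c = (- q) ^ c * X - (- p) ^ c * Y" if "c \<le> Suc m" for c
    using that
  proof (induction c rule: induct_nat_012)
    case (ge2 c)
    then have rec: "w (Suc (Suc c)) = - (p + q) * w (Suc c) - p * q * w c"
      using q[of c] \<kappa>q[of c] by (simp add: algebra_simps eq_neg_iff_add_eq_0)
    have "(p - q) * w (Suc (Suc c)) =
        - (p + q) * ((p - q) * w (Suc c)) - p * q * ((p - q) * w c)"
      by (simp add: rec algebra_simps)
    moreover have "(p - q) * w (Suc c) = (- q) ^ Suc c * X - (- p) ^ Suc c * Y"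
      and "(p - q) * w c = (- q) ^ c * X - (- p) ^ c * Y" using ge2 by auto
    ultimately show ?case by (simp only:) (simp add: algebra_simps)
  qed (auto simp: X Y algebra_simps)
  \<comment> \<open>At index m + 2 the pairing with column m of \<open>upqa\<close> is no longer
    forced to vanish and contributes one extra determinant.\<close>
  have w': "(p - q) * w (Suc c) = (- q) ^ Suc c * X - (- p) ^ Suc c * Y
      + (p - q) * cdet (Suc m) upqa * of_bool (c = Suc m)" if "c \<le> Suc m" for c
  proof (cases "c = Suc m")
    case True
    have rec: "w (Suc (Suc m)) = cdet (Suc m) upqa - (p + q) * w (Suc m) - p * q * w m"
      using q[of m] \<kappa>q[of m] by (simp add: algebra_simps)
    have "(p - q) * w (Suc (Suc m)) = (p - q) * cdet (Suc m) upqa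
        - (p + q) * ((p - q) * w (Suc m)) - p * q * ((p - q) * w m)"
      by (simp add: rec algebra_simps)
    moreover have "(p - q) * w (Suc m) = (- q) ^ Suc m * X - (- p) ^ Suc m * Y"
      and "(p - q) * w m = (- q) ^ m * X - (- p) ^ m * Y" by (rule w; simp)+
    ultimately have "(p - q) * w (Suc (Suc m)) = (- q) ^ Suc (Suc m) * X
        - (- p) ^ Suc (Suc m) * Y + (p - q) * cdet (Suc m) upqa"
      by (simp only:) (simp add: algebra_simps)
    then show ?thesis using True by simp
  qed (use that w[of "Suc c"] in auto)
  have "((p - q) * (gdet m upqa + e * cdet (Suc m) upqa)) * cdet (Suc m) u
      = ((p - q) * cdet (Suc m) upqa) * gdet m u
      + (- 1) ^ m * (((d - e * q) * X) * cdet (Suc m) uq + (- (d - e * p) * Y) * cdet (Suc m) up)"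
  proof (rule border_pairing)
    fix c assume c: "c \<le> Suc m"
    \<comment> \<open>The constant \<open>\<alpha>2 * a ^ 2 - a ^ 3\<close> is g_3(-a). The weight
      attached to \<open>u c i\<close> depends on i alone, so the functional is a combination of the
      rows of \<open>u\<close>.\<close>
    have "(\<Sum>i\<le>m. \<kappa> i * (\<gamma> i - (\<alpha>2 * a ^ 2 - a ^ 3)) * u c i)
        = (\<Sum>i\<le>m. \<kappa> i * upqa c i) + e * w (Suc c) + d * w c"
      unfolding w_def sum_distrib_left sum.distrib[symmetric]
    proof (intro sum.cong refl)
      fix i assume "i \<in> {..m}"
      then have i: "i < Suc m" by simp
      have "(\<gamma> i - (\<alpha>2 * a ^ 2 - a ^ 3)) * u c i
          = u (Suc (Suc (Suc c))) i + \<alpha>2 * u (Suc (Suc c)) i - (\<alpha>2 * a ^ 2 - a ^ 3) * u c i"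
        using cubic[OF i, of c] by (simp add: algebra_simps eval_nat_numeral)
      also have "\<dots> = upqa c i + e * ua (Suc c) i + d * ua c i"
        using i by (simp add: upqa upa ua e_def d_def algebra_simps power2_eq_square power3_eq_cube)
      finally show "\<kappa> i * (\<gamma> i - (\<alpha>2 * a ^ 2 - a ^ 3)) * u c i
          = \<kappa> i * upqa c i + e * (\<kappa> i * ua (Suc c) i) + d * (\<kappa> i * ua c i)"
        by (simp add: mult.assoc) (simp add: algebra_simps)
    qed
    then have "(p - q) * (\<Sum>i\<le>m. \<kappa> i * (\<gamma> i - (\<alpha>2 * a ^ 2 - a ^ 3)) * u c i)
        = (p - q) * (\<Sum>i\<le>m. \<kappa> i * upqa c i) + e * ((p - q) * w (Suc c)) + d * ((p - q) * w c)"
      by (simp add: algebra_simps)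
    also have "\<dots> = ((p - q) * cdet (Suc m) upqa) * of_bool (c = m)
        + ((p - q) * (gdet m upqa + e * cdet (Suc m) upqa)) * of_bool (c = Suc m)
        + ((d - e * q) * X) * (- q) ^ c + (- (d - e * p) * Y) * (- p) ^ c"
      unfolding \<kappa>q[OF c] w[OF c] w'[OF c] by (simp add: algebra_simps)
    finally show "(\<Sum>i\<le>m. ((p - q) * (\<kappa> i * (\<gamma> i - (\<alpha>2 * a ^ 2 - a ^ 3)))) * u c i)
        = ((p - q) * cdet (Suc m) upqa) * of_bool (c = m)
        + ((p - q) * (gdet m upqa + e * cdet (Suc m) upqa)) * of_bool (c = Suc m)
        + ((d - e * q) * X) * (- q) ^ c + (- (d - e * p) * Y) * (- p) ^ c"
      by (simp add: sum_distrib_left mult.assoc)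
  qed (auto simp: uq up)
  also have "(- 1) ^ m * (((d - e * q) * X) * cdet (Suc m) uq + (- (d - e * p) * Y) * cdet (Suc m) up)
      = (d - e * q) * cdet (Suc m) upa * cdet (Suc m) uq
        - (d - e * p) * cdet (Suc m) uqa * cdet (Suc m) up"
    unfolding X_def Y_def by (cases "even m") (simp_all add: algebra_simps)
  \<comment> \<open>The remainder e T + d at T = -q, and next at T = -p.\<close>
  also have "d - e * q = q ^ 2 + q * a + a ^ 2 - \<alpha>2 * (q + a)"
    by (simp add: d_def e_def algebra_simps power2_eq_square)
  also have "d - e * p = p ^ 2 + p * a + a ^ 2 - \<alpha>2 * (p + a)"
    by (simp add: d_def e_def algebra_simps power2_eq_square)
  finally show ?thesis unfolding e_def by (simp add: algebra_simps)
qed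


section \<open>Shift relations of the Casoratian entries, and the bilinear equations\<close>

lemma casoratian_f: "casoratian \<psi> [0..<N] \<xi> = cdet N (\<lambda>l i. \<psi> (Suc i) l \<xi>)"
  unfolding casoratian_def cdet_def by (intro arg_cong[where f = det] eq_matI) auto

lemma casoratian_g:
  "casoratian \<psi> ([0..<Suc m - 1] @ [Suc m]) \<xi> = gdet m (\<lambda>l i. \<psi> (Suc i) l \<xi>)"
  unfolding casoratian_def gdet_def cdet_def
  by (intro arg_cong[where f = det] eq_matI) (auto simp: nth_append less_Suc_eq)

text \<open>Raising n gives a factor -\<omega> + p, and -\<omega> raises l. The assumption excludes
  the base 0, for which the step from exponent -1 to 0 fails with \<open>powi\<close>.\<close>

lemma psi_Suc_n:
  assumes "\<forall>s\<in>{0..2}. p \<noteq> \<omega> s (k j)"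
  shows "psi p q a b \<omega> k \<rho> j l (n + 1, m, \<alpha>, \<beta>)
    = psi p q a b \<omega> k \<rho> j (Suc l) (n, m, \<alpha>, \<beta>) + p * psi p q a b \<omega> k \<rho> j l (n, m, \<alpha>, \<beta>)"
  unfolding psi_def prod.case sum_distrib_left sum.distrib[symmetric]
proof (intro sum.cong refl)
  fix s :: nat assume "s \<in> {0..2}"
  then have "(p - \<omega> s (k j)) powi (n + 1) = (p - \<omega> s (k j)) powi n * (p - \<omega> s (k j))"
    using assms by (simp add: power_int_add_1)
  then show "(- \<omega> s (k j)) ^ l * (p - \<omega> s (k j)) powi (n + 1) * (q - \<omega> s (k j)) powi m
      * (a - \<omega> s (k j)) powi \<alpha> * (b - \<omega> s (k j)) powi \<beta> * \<rho> j s
    = (- \<omega> s (k j)) ^ Suc l * (p - \<omega> s (k j)) powi n * (q - \<omega> s (k j)) powi m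
      * (a - \<omega> s (k j)) powi \<alpha> * (b - \<omega> s (k j)) powi \<beta> * \<rho> j s
    + p * ((- \<omega> s (k j)) ^ l * (p - \<omega> s (k j)) powi n * (q - \<omega> s (k j)) powi m
      * (a - \<omega> s (k j)) powi \<alpha> * (b - \<omega> s (k j)) powi \<beta> * \<rho> j s)"
    by (simp only:) (simp add: algebra_simps)
qed

lemma psi_Suc_m:
  assumes "\<forall>s\<in>{0..2}. q \<noteq> \<omega> s (k j)"
  shows "psi p q a b \<omega> k \<rho> j l (n, m + 1, \<alpha>, \<beta>)
    = psi p q a b \<omega> k \<rho> j (Suc l) (n, m, \<alpha>, \<beta>) + q * psi p q a b \<omega> k \<rho> j l (n, m, \<alpha>, \<beta>)"
  unfolding psi_def prod.case sum_distrib_left sum.distrib[symmetric]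
proof (intro sum.cong refl)
  fix s :: nat assume "s \<in> {0..2}"
  then have "(q - \<omega> s (k j)) powi (m + 1) = (q - \<omega> s (k j)) powi m * (q - \<omega> s (k j))"
    using assms by (simp add: power_int_add_1)
  then show "(- \<omega> s (k j)) ^ l * (p - \<omega> s (k j)) powi n * (q - \<omega> s (k j)) powi (m + 1)
      * (a - \<omega> s (k j)) powi \<alpha> * (b - \<omega> s (k j)) powi \<beta> * \<rho> j s
    = (- \<omega> s (k j)) ^ Suc l * (p - \<omega> s (k j)) powi n * (q - \<omega> s (k j)) powi m
      * (a - \<omega> s (k j)) powi \<alpha> * (b - \<omega> s (k j)) powi \<beta> * \<rho> j s
    + q * ((- \<omega> s (k j)) ^ l * (p - \<omega> s (k j)) powi n * (q - \<omega> s (k j)) powi m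
      * (a - \<omega> s (k j)) powi \<alpha> * (b - \<omega> s (k j)) powi \<beta> * \<rho> j s)"
    by (simp only:) (simp add: algebra_simps)
qed

text \<open>Written from \<alpha> - 1 up to \<alpha>, because \<open>und\<close> lowers \<alpha> and
  the lowered point serves as the base.\<close>

lemma psi_Suc_alpha:
  assumes "\<forall>s\<in>{0..2}. a \<noteq> \<omega> s (k j)"
  shows "psi p q a b \<omega> k \<rho> j l (n, m, \<alpha>, \<beta>)
    = psi p q a b \<omega> k \<rho> j (Suc l) (n, m, \<alpha> - 1, \<beta>) + a * psi p q a b \<omega> k \<rho> j l (n, m, \<alpha> - 1, \<beta>)"
  unfolding psi_def prod.case sum_distrib_left sum.distrib[symmetric]
proof (intro sum.cong refl)
  fix s :: nat assume "s \<in> {0..2}"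
  then have "(a - \<omega> s (k j)) powi \<alpha> = (a - \<omega> s (k j)) powi (\<alpha> - 1) * (a - \<omega> s (k j))"
    using assms power_int_add_1[of "a - \<omega> s (k j)" "\<alpha> - 1"] by simp
  then show "(- \<omega> s (k j)) ^ l * (p - \<omega> s (k j)) powi n * (q - \<omega> s (k j)) powi m
      * (a - \<omega> s (k j)) powi \<alpha> * (b - \<omega> s (k j)) powi \<beta> * \<rho> j s
    = (- \<omega> s (k j)) ^ Suc l * (p - \<omega> s (k j)) powi n * (q - \<omega> s (k j)) powi m
      * (a - \<omega> s (k j)) powi (\<alpha> - 1) * (b - \<omega> s (k j)) powi \<beta> * \<rho> j s
    + a * ((- \<omega> s (k j)) ^ l * (p - \<omega> s (k j)) powi n * (q - \<omega> s (k j)) powi m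
      * (a - \<omega> s (k j)) powi (\<alpha> - 1) * (b - \<omega> s (k j)) powi \<beta> * \<rho> j s)"
    by (simp only:) (simp add: algebra_simps)
qed

lemma g3_omega:
  assumes "omega_roots \<alpha>2 \<omega> k" "s \<le> 2"
  shows "g3 \<alpha>2 (- \<omega> s k) = g3 \<alpha>2 (- k)"
proof -
  have "s = 0 \<or> s = 1 \<or> s = 2" using assms(2) by linarith
  moreover have "g3 \<alpha>2 (- \<omega> s k) - g3 \<alpha>2 (- k)
      = - ((\<omega> s k - \<omega> 0 k) * (\<omega> s k - \<omega> 1 k) * (\<omega> s k - \<omega> 2 k))"
    using assms(1) unfolding omega_roots_def by blast
  ultimately show ?thesis by auto
qed

text \<open>Each summand is an eigenvector of T with eigenvalue -\<omega>, and g_3 takes the same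
  value at all three eigenvalues of row j.\<close>

lemma psi_cubic:
  assumes "omega_roots \<alpha>2 \<omega> (k j)"
  shows "psi p q a b \<omega> k \<rho> j (l + 3) \<xi> + \<alpha>2 * psi p q a b \<omega> k \<rho> j (l + 2) \<xi>
    = g3 \<alpha>2 (- k j) * psi p q a b \<omega> k \<rho> j l \<xi>"
proof -
  obtain n m \<alpha> \<beta> where \<xi>: "\<xi> = (n, m, \<alpha>, \<beta>)" by (cases \<xi>)
  show ?thesis
    unfolding \<xi> psi_def prod.case sum_distrib_left sum.distrib[symmetric]
  proof (intro sum.cong refl)
    fix s :: nat assume "s \<in> {0..2}"
    then have "g3 \<alpha>2 (- k j) = g3 \<alpha>2 (- \<omega> s (k j))" using g3_omega[OF assms] by simp
    also have "\<dots> = (- \<omega> s (k j)) ^ 3 + \<alpha>2 * (- \<omega> s (k j)) ^ 2" by (simp only: g3_def)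
    finally show "(- \<omega> s (k j)) ^ (l + 3) * (p - \<omega> s (k j)) powi n * (q - \<omega> s (k j)) powi m
        * (a - \<omega> s (k j)) powi \<alpha> * (b - \<omega> s (k j)) powi \<beta> * \<rho> j s
      + \<alpha>2 * ((- \<omega> s (k j)) ^ (l + 2) * (p - \<omega> s (k j)) powi n * (q - \<omega> s (k j)) powi m
        * (a - \<omega> s (k j)) powi \<alpha> * (b - \<omega> s (k j)) powi \<beta> * \<rho> j s)
      = g3 \<alpha>2 (- k j) * ((- \<omega> s (k j)) ^ l * (p - \<omega> s (k j)) powi n * (q - \<omega> s (k j)) powi m
        * (a - \<omega> s (k j)) powi \<alpha> * (b - \<omega> s (k j)) powi \<beta> * \<rho> j s)"
      by (simp only: power_add) (simp only: ring_distribs mult_ac)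
  qed
qed

text \<open>G_3(-p, -a) contains the factor p - a; cancelling it gives the form in which
  \<open>casorati_cubic\<close> delivers the coefficients.\<close>

lemma coefp_eq:
  assumes "p \<noteq> a"
  shows "coefp \<alpha>2 a p = p ^ 2 + p * a + a ^ 2 - \<alpha>2 * (p + a)"
  using assms
  by (simp add: coefp_def G3_def g3_def field_simps power2_eq_square power3_eq_cube)

lemma casoratian_solves_bilinear:
  assumes pa: "p \<noteq> a" and qa: "q \<noteq> a" and N: "N \<ge> 1"
    and roots: "\<forall>j\<in>{1..N}. omega_roots \<alpha>2 \<omega> (k j)"
    and ne: "\<forall>j\<in>{1..N}. \<forall>s\<in>{0..2}. p \<noteq> \<omega> s (k j) \<and> q \<noteq> \<omega> s (k j) \<and> a \<noteq> \<omega> s (k j)"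
  shows "solves_bilinear \<alpha>2 p q a
    (casoratian (psi p q a b \<omega> k \<rho>) [0..<N])
    (casoratian (psi p q a b \<omega> k \<rho>) ([0..<N - 1] @ [N]))"
proof -
  obtain M where M: "N = Suc M" using N by (cases N) auto
  define u where "u \<xi> l i = psi p q a b \<omega> k \<rho> (Suc i) l \<xi>" for \<xi> l i
  define f where "f = casoratian (psi p q a b \<omega> k \<rho>) [0..<N]"
  define g where "g = casoratian (psi p q a b \<omega> k \<rho>) ([0..<N - 1] @ [N])"
  have f: "f \<xi> = cdet (Suc M) (u \<xi>)" for \<xi>
    unfolding f_def M casoratian_f u_def ..
  have g: "g \<xi> = gdet M (u \<xi>)" for \<xi>
    unfolding g_def M casoratian_g u_def ..
  have n: "u (n + 1, m, \<alpha>, \<beta>) l i = u (n, m, \<alpha>, \<beta>) (Suc l) i + p * u (n, m, \<alpha>, \<beta>) l i"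
    if "i < Suc M" for n m \<alpha> \<beta> l i
    unfolding u_def by (rule psi_Suc_n) (use ne that M in auto)
  have m: "u (n, m + 1, \<alpha>, \<beta>) l i = u (n, m, \<alpha>, \<beta>) (Suc l) i + q * u (n, m, \<alpha>, \<beta>) l i"
    if "i < Suc M" for n m \<alpha> \<beta> l i
    unfolding u_def by (rule psi_Suc_m) (use ne that M in auto)
  have \<alpha>: "u (n, m, \<alpha>, \<beta>) l i = u (n, m, \<alpha> - 1, \<beta>) (Suc l) i + a * u (n, m, \<alpha> - 1, \<beta>) l i"
    if "i < Suc M" for n m \<alpha> \<beta> l i
    unfolding u_def by (rule psi_Suc_alpha) (use ne that M in auto)
  have cubic: "u \<xi> (l + 3) i + \<alpha>2 * u \<xi> (l + 2) i = g3 \<alpha>2 (- k (Suc i)) * u \<xi> l i"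
    if "i < Suc M" for \<xi> l i
    unfolding u_def by (rule psi_cubic) (use roots that M in auto)
  show ?thesis
    unfolding solves_bilinear_def f_def[symmetric] g_def[symmetric]
  proof
    fix \<xi> :: "int \<times> int \<times> int \<times> int"
    obtain n0 m0 \<alpha>0 \<beta>0 where \<xi>: "\<xi> = (n0, m0, \<alpha>0, \<beta>0)" by (cases \<xi>)
    \<comment> \<open>The base point is the lowered one, \<alpha> - 1, so the unshifted f and g are
      the a-shifts of \<open>und f\<close> and \<open>und g\<close>.\<close>
    have "B1 p a f g \<xi> = 0"
      using casorati_two_shifts[of M "u (n0 + 1, m0, \<alpha>0 - 1, \<beta>0)" "u (n0, m0, \<alpha>0 - 1, \<beta>0)" p
          "u (n0, m0, \<alpha>0, \<beta>0)" a "u (n0 + 1, m0, \<alpha>0, \<beta>0)", OF n \<alpha> \<alpha>]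
      unfolding B1_def \<xi> til_def und_def prod.case f[symmetric] g[symmetric]
      by (simp add: algebra_simps)
    moreover have "B2 q a f g \<xi> = 0"
      using casorati_two_shifts[of M "u (n0, m0 + 1, \<alpha>0 - 1, \<beta>0)" "u (n0, m0, \<alpha>0 - 1, \<beta>0)" q
          "u (n0, m0, \<alpha>0, \<beta>0)" a "u (n0, m0 + 1, \<alpha>0, \<beta>0)", OF m \<alpha> \<alpha>]
      unfolding B2_def \<xi> hat_def und_def prod.case f[symmetric] g[symmetric]
      by (simp add: algebra_simps)
    moreover have "B3 p q f g \<xi> = 0"
      using casorati_two_shifts[of M "u (n0 + 1, m0, \<alpha>0, \<beta>0)" "u (n0, m0, \<alpha>0, \<beta>0)" p
          "u (n0, m0 + 1, \<alpha>0, \<beta>0)" q "u (n0 + 1, m0 + 1, \<alpha>0, \<beta>0)", OF n m m]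
      unfolding B3_def \<xi> til_def hat_def prod.case f[symmetric] g[symmetric] by simp
    \<comment> \<open>Again based at \<alpha> - 1, now with all three shifts and the cubic
      relation.\<close>
    moreover have "B4 \<alpha>2 p q a f g \<xi> = 0"
      using casorati_cubic[of M "u (n0 + 1, m0, \<alpha>0 - 1, \<beta>0)" "u (n0, m0, \<alpha>0 - 1, \<beta>0)" p
          "u (n0, m0 + 1, \<alpha>0 - 1, \<beta>0)" q "u (n0, m0, \<alpha>0, \<beta>0)" a
          "u (n0 + 1, m0, \<alpha>0, \<beta>0)" "u (n0, m0 + 1, \<alpha>0, \<beta>0)" "u (n0 + 1, m0 + 1, \<alpha>0, \<beta>0)"
          \<alpha>2 "\<lambda>i. g3 \<alpha>2 (- k (Suc i))", OF n m \<alpha> n m m cubic]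
      unfolding B4_def \<xi> til_def hat_def und_def prod.case f[symmetric] g[symmetric]
        coefp_eq[OF pa] coefp_eq[OF qa]
      by simp
    ultimately show "B1 p a f g \<xi> = 0 \<and> B2 q a f g \<xi> = 0 \<and> B3 p q f g \<xi> = 0
        \<and> B4 \<alpha>2 p q a f g \<xi> = 0" by blast
  qed
qed

section \<open>Shifts of the background and of the transformed variables\<close>

lemma til_x_bg: "p \<noteq> a \<Longrightarrow> til (x_bg p q a c1) \<xi> = x_bg p q a c1 \<xi> / (p - a)"
  by (cases \<xi>) (simp add: til_def x_bg_def power_int_diff)

lemma hat_x_bg: "q \<noteq> a \<Longrightarrow> hat (x_bg p q a c1) \<xi> = x_bg p q a c1 \<xi> / (q - a)"
  by (cases \<xi>) (simp add: hat_def x_bg_def power_int_diff)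

lemma til_z_bg: "til (z_bg p q c3 c2) \<xi> = z_bg p q c3 c2 \<xi> + c3 - p"
  by (cases \<xi>) (simp add: til_def z_bg_def algebra_simps)

lemma hat_z_bg: "hat (z_bg p q c3 c2) \<xi> = z_bg p q c3 c2 \<xi> + c3 - q"
  by (cases \<xi>) (simp add: hat_def z_bg_def algebra_simps)

lemma til_x_tr: "til (x_tr xa f) \<xi> = til xa \<xi> * (til (und f) \<xi> / til f \<xi>)"
  by (cases \<xi>) (simp add: til_def x_tr_def und_def)

lemma hat_x_tr: "hat (x_tr xa f) \<xi> = hat xa \<xi> * (hat (und f) \<xi> / hat f \<xi>)"
  by (cases \<xi>) (simp add: hat_def x_tr_def und_def)

lemma til_y_tr: "til (y_tr xa ya f g) \<xi>
    = til ya \<xi> * (til (und f) \<xi> / til f \<xi>) + til xa \<xi> * (til (und g) \<xi> / til f \<xi>)"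
  by (cases \<xi>) (simp add: til_def y_tr_def und_def)

lemma hat_y_tr: "hat (y_tr xa ya f g) \<xi>
    = hat ya \<xi> * (hat (und f) \<xi> / hat f \<xi>) + hat xa \<xi> * (hat (und g) \<xi> / hat f \<xi>)"
  by (cases \<xi>) (simp add: hat_def y_tr_def und_def)

lemma til_y_bg: "til (y_bg a c3 xa z0) \<xi> = til xa \<xi> * (til z0 \<xi> + a - c3)"
  by (cases \<xi>) (simp add: til_def y_bg_def)

lemma hat_y_bg: "hat (y_bg a c3 xa z0) \<xi> = hat xa \<xi> * (hat z0 \<xi> + a - c3)"
  by (cases \<xi>) (simp add: hat_def y_bg_def)

lemma til_z_tr: "til (z_tr z0 f g) \<xi> = til z0 \<xi> + til g \<xi> / til f \<xi>"
  by (cases \<xi>) (simp add: til_def z_tr_def)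

lemma hat_z_tr: "hat (z_tr z0 f g) \<xi> = hat z0 \<xi> + hat g \<xi> / hat f \<xi>"
  by (cases \<xi>) (simp add: hat_def z_tr_def)

lemma hat_til_z_tr:
  "hat (til (z_tr z0 f g)) \<xi> = hat (til z0) \<xi> + hat (til g) \<xi> / hat (til f) \<xi>"
  by (cases \<xi>) (simp add: til_def hat_def z_tr_def)

lemma hat_til_z_bg: "hat (til (z_bg p q c3 c2)) \<xi> = z_bg p q c3 c2 \<xi> + 2 * c3 - p - q"
  by (cases \<xi>) (simp add: til_def hat_def z_bg_def algebra_simps)

section \<open>The A2 system expressed through the bilinear equations\<close>

text \<open>The increment c3 - p of \<open>z_bg\<close> meets the summand a - c3 of
  \<open>y_bg\<close>: both z_0 and c3 cancel, and only p - a is left.\<close>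

lemma A1_tr:
  assumes "p \<noteq> a" "f \<xi> \<noteq> 0" "til f \<xi> \<noteq> 0"
  shows "A1 (x_tr (x_bg p q a c1) f)
      (y_tr (x_bg p q a c1) (y_bg a c3 (x_bg p q a c1) (z_bg p q c3 c2)) f g)
      (z_tr (z_bg p q c3 c2) f g) \<xi>
    = til (x_bg p q a c1) \<xi> * B1 p a f g \<xi> / (f \<xi> * til f \<xi>)"
proof -
  have "x_bg p q a c1 \<xi> = til (x_bg p q a c1) \<xi> * (p - a)"
    using assms(1) by (simp add: til_x_bg)
  then show ?thesis
    unfolding A1_def til_x_tr til_y_tr til_y_bg til_z_bg B1_def
    unfolding x_tr_def z_tr_def
    using assms(2,3) by (simp add: divide_simps) (simp add: algebra_simps)
qed

lemma A2_tr:
  assumes "q \<noteq> a" "f \<xi> \<noteq> 0" "hat f \<xi> \<noteq> 0"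
  shows "A2 (x_tr (x_bg p q a c1) f)
      (y_tr (x_bg p q a c1) (y_bg a c3 (x_bg p q a c1) (z_bg p q c3 c2)) f g)
      (z_tr (z_bg p q c3 c2) f g) \<xi>
    = hat (x_bg p q a c1) \<xi> * B2 q a f g \<xi> / (f \<xi> * hat f \<xi>)"
proof -
  have "x_bg p q a c1 \<xi> = hat (x_bg p q a c1) \<xi> * (q - a)"
    using assms(1) by (simp add: hat_x_bg)
  then show ?thesis
    unfolding A2_def hat_x_tr hat_y_tr hat_y_bg hat_z_bg B2_def
    unfolding x_tr_def z_tr_def
    using assms(2,3) by (simp add: divide_simps) (simp add: algebra_simps)
qed

text \<open>In the abbreviations of the proof, A_3 divided by x_a is -(C + E)/F - E/(H D) with H D =
  -(B + F). The numerator over F H D is therefore (C + E)(B + F) - E F, which expands to the stated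
  B C + F C + E B.\<close>

lemma A3_tr:
  fixes f g :: lat
  assumes c3: "c3 = \<alpha>2 / 3" and "p \<noteq> q" "p \<noteq> a" "q \<noteq> a"
    and ne: "f \<xi> \<noteq> 0" "til f \<xi> \<noteq> 0" "hat f \<xi> \<noteq> 0" "hat (til f) \<xi> \<noteq> 0"
    and z: "z = z_tr (z_bg p q c3 c2) f g" and D0: "til z \<xi> \<noteq> hat z \<xi>"
  shows "A3 (coefP \<alpha>2 a p) (coefP \<alpha>2 a q) (x_tr (x_bg p q a c1) f)
      (y_tr (x_bg p q a c1) (y_bg a c3 (x_bg p q a c1) (z_bg p q c3 c2)) f g) z \<xi>
    = x_bg p q a c1 \<xi> *
       ((B3 p q f g \<xi> * B4 \<alpha>2 p q a f g \<xi>
         + (p - q) * f \<xi> * hat (til f) \<xi> * B4 \<alpha>2 p q a f g \<xi>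
         + (coefp \<alpha>2 a p * hat f \<xi> * til (und f) \<xi> - coefp \<alpha>2 a q * til f \<xi> * hat (und f) \<xi>)
             * B3 p q f g \<xi>)
        / ((p - q) * f \<xi> * til f \<xi> * hat f \<xi> * hat (til f) \<xi> * (til z \<xi> - hat z \<xi>)))"
proof -
  define D where "D = til z \<xi> - hat z \<xi>"
  define E where "E = coefp \<alpha>2 a p * hat f \<xi> * til (und f) \<xi>
    - coefp \<alpha>2 a q * til f \<xi> * hat (und f) \<xi>"
  define B where "B = B3 p q f g \<xi>"
  define C where "C = B4 \<alpha>2 p q a f g \<xi>"
  define F where "F = (p - q) * (f \<xi> * hat (til f) \<xi>)"
  define H where "H = til f \<xi> * hat f \<xi>"
  have D: "D \<noteq> 0" using D0 by (simp add: D_def)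
  have F: "F \<noteq> 0" using ne assms(2) by (simp add: F_def)
  have H: "H \<noteq> 0" using ne by (simp add: H_def)
  have DB: "D * H = - (B + F)"
    using ne by (simp add: D_def B_def B3_def F_def H_def z til_z_tr hat_z_tr til_z_bg hat_z_bg field_simps)
  \<comment> \<open>The double shift of z_0 contributes 2 c3 and \<open>y_bg\<close> one more c3;
    their sum is the \<alpha>2 of \<open>B4\<close>.\<close>
  have \<alpha>2: "\<alpha>2 = 3 * c3" unfolding c3 by simp
  have 1: "und f \<xi> / f \<xi> * (hat (til z) \<xi> - z_bg p q c3 c2 \<xi> - a + c3) - und g \<xi> / f \<xi>
      = - (C + E) / F"
    using ne assms(2)
    by (simp add: C_def E_def F_def B4_def z hat_til_z_tr hat_til_z_bg divide_simps)
      (simp add: \<alpha>2 algebra_simps)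
  have 2: "(coefp \<alpha>2 a p * (til (und f) \<xi> / til f \<xi>) - coefp \<alpha>2 a q * (hat (und f) \<xi> / hat f \<xi>))
      = E / H"
    using ne by (simp add: E_def H_def divide_simps)
  have 3: "coefP \<alpha>2 a p * til (x_tr (x_bg p q a c1) f) \<xi>
      = x_bg p q a c1 \<xi> * (coefp \<alpha>2 a p * (til (und f) \<xi> / til f \<xi>))"
    using assms(3) by (simp add: til_x_tr til_x_bg coefP_def coefp_def)
  have 4: "coefP \<alpha>2 a q * hat (x_tr (x_bg p q a c1) f) \<xi>
      = x_bg p q a c1 \<xi> * (coefp \<alpha>2 a q * (hat (und f) \<xi> / hat f \<xi>))"
    using assms(4) by (simp add: hat_x_tr hat_x_bg coefP_def coefp_def)
  have "A3 (coefP \<alpha>2 a p) (coefP \<alpha>2 a q) (x_tr (x_bg p q a c1) f)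
      (y_tr (x_bg p q a c1) (y_bg a c3 (x_bg p q a c1) (z_bg p q c3 c2)) f g) z \<xi>
     = x_bg p q a c1 \<xi> * (und f \<xi> / f \<xi> * (hat (til z) \<xi> - z_bg p q c3 c2 \<xi> - a + c3) - und g \<xi> / f \<xi>
       - (coefp \<alpha>2 a p * (til (und f) \<xi> / til f \<xi>) - coefp \<alpha>2 a q * (hat (und f) \<xi> / hat f \<xi>)) / D)"
    unfolding A3_def 3 4 D_def[symmetric]
    by (simp add: x_tr_def y_tr_def y_bg_def add_divide_distrib diff_divide_distrib algebra_simps)
  also have "\<dots> = x_bg p q a c1 \<xi> * (- (C + E) / F - E / H / D)"
    unfolding 1 2 ..
  also have "- (C + E) / F - E / H / D = (- (C + E) * (D * H) - E * F) / (F * H * D)"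
    using D F H by (simp add: divide_simps)
  also have "\<dots> = (B * C + F * C + E * B) / (F * H * D)"
    unfolding DB by (simp add: algebra_simps)
  finally show ?thesis
    unfolding B_def C_def D_def E_def F_def H_def by (simp add: mult_ac)
qed

lemma background_solves_A2:
  assumes c3: "c3 = \<alpha>2 / 3" and "p \<noteq> q" and pa: "p \<noteq> a" and qa: "q \<noteq> a"
  shows "solves_A2 (coefP \<alpha>2 a p) (coefP \<alpha>2 a q) (x_bg p q a c1)
    (y_bg a c3 (x_bg p q a c1) (z_bg p q c3 c2)) (z_bg p q c3 c2)"
  unfolding solves_A2_def
proof (intro allI conjI)
  fix \<xi>
  define X where "X = x_bg p q a c1 \<xi>"
  have \<alpha>2: "\<alpha>2 = 3 * c3" unfolding c3 by simp
  show "til (z_bg p q c3 c2) \<xi> \<noteq> hat (z_bg p q c3 c2) \<xi>"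
    using assms(2) by (simp add: til_z_bg hat_z_bg)
  show "A1 (x_bg p q a c1) (y_bg a c3 (x_bg p q a c1) (z_bg p q c3 c2)) (z_bg p q c3 c2) \<xi> = 0"
    using pa by (simp add: A1_def til_y_bg til_x_bg til_z_bg divide_simps) (simp add: algebra_simps)
  show "A2 (x_bg p q a c1) (y_bg a c3 (x_bg p q a c1) (z_bg p q c3 c2)) (z_bg p q c3 c2) \<xi> = 0"
    using qa by (simp add: A2_def hat_y_bg hat_x_bg hat_z_bg divide_simps) (simp add: algebra_simps)
  have "coefP \<alpha>2 a p * til (x_bg p q a c1) \<xi> - coefP \<alpha>2 a q * hat (x_bg p q a c1) \<xi>
      = (coefp \<alpha>2 a p - coefp \<alpha>2 a q) * X"
    using pa qa by (simp add: til_x_bg hat_x_bg X_def algebra_simps coefP_def coefp_def)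
  \<comment> \<open>The difference p_a - q_a contains the factor p - q, which cancels against the
    denominator q - p formed by the shifts of z_0.\<close>
  also have "\<dots> = (q - p) * (X * (\<alpha>2 - p - q - a))"
    by (simp add: coefp_eq[OF pa] coefp_eq[OF qa] algebra_simps power2_eq_square)
  finally have "(coefP \<alpha>2 a p * til (x_bg p q a c1) \<xi> - coefP \<alpha>2 a q * hat (x_bg p q a c1) \<xi>)
      / (til (z_bg p q c3 c2) \<xi> - hat (z_bg p q c3 c2) \<xi>) = X * (\<alpha>2 - p - q - a)"
    using assms(2) by (simp add: til_z_bg hat_z_bg)
  then show "A3 (coefP \<alpha>2 a p) (coefP \<alpha>2 a q) (x_bg p q a c1)
      (y_bg a c3 (x_bg p q a c1) (z_bg p q c3 c2)) (z_bg p q c3 c2) \<xi> = 0"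
    by (simp add: A3_def y_bg_def hat_til_z_bg X_def[symmetric] \<alpha>2 algebra_simps)
qed

lemma bilinear_solves_A2:
  assumes c3: "c3 = \<alpha>2 / 3" and pq: "p \<noteq> q" and pa: "p \<noteq> a" and qa: "q \<noteq> a"
    and ne: "\<And>\<xi>. f \<xi> \<noteq> 0" and z: "z = z_tr (z_bg p q c3 c2) f g"
    and D: "\<And>\<xi>. til z \<xi> \<noteq> hat z \<xi>"
    and bil: "solves_bilinear \<alpha>2 p q a f g"
  shows "solves_A2 (coefP \<alpha>2 a p) (coefP \<alpha>2 a q) (x_tr (x_bg p q a c1) f)
    (y_tr (x_bg p q a c1) (y_bg a c3 (x_bg p q a c1) (z_bg p q c3 c2)) f g) z"
  unfolding solves_A2_def
proof (intro allI conjI)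
  fix \<xi>
  have ne': "til f \<xi> \<noteq> 0" "hat f \<xi> \<noteq> 0" "hat (til f) \<xi> \<noteq> 0"
    using ne by (auto simp: til_def hat_def split: prod.split)
  have B: "B1 p a f g \<xi> = 0" "B2 q a f g \<xi> = 0" "B3 p q f g \<xi> = 0" "B4 \<alpha>2 p q a f g \<xi> = 0"
    using bil unfolding solves_bilinear_def by blast+
  show "til z \<xi> \<noteq> hat z \<xi>" by (fact D)
  show "A1 (x_tr (x_bg p q a c1) f)
      (y_tr (x_bg p q a c1) (y_bg a c3 (x_bg p q a c1) (z_bg p q c3 c2)) f g) z \<xi> = 0"
    unfolding z by (subst A1_tr[OF pa ne ne'(1)]) (simp add: B)
  show "A2 (x_tr (x_bg p q a c1) f)
      (y_tr (x_bg p q a c1) (y_bg a c3 (x_bg p q a c1) (z_bg p q c3 c2)) f g) z \<xi> = 0"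
    unfolding z by (subst A2_tr[OF qa ne ne'(2)]) (simp add: B)
  show "A3 (coefP \<alpha>2 a p) (coefP \<alpha>2 a q) (x_tr (x_bg p q a c1) f)
      (y_tr (x_bg p q a c1) (y_bg a c3 (x_bg p q a c1) (z_bg p q c3 c2)) f g) z \<xi> = 0"
    by (subst A3_tr[OF c3 pq pa qa ne ne' z D]) (simp add: B)
qed

theorem mainTheorem15:
  fixes \<alpha>2 c1 c2 c3 p q a P Q pa qa :: complex
    and xa ya z0 :: lat
  assumes "p \<noteq> q" and "p \<noteq> a" and "q \<noteq> a"
    and c3: "c3 = \<alpha>2 / 3"
    and P: "P = coefP \<alpha>2 a p" and Q: "Q = coefP \<alpha>2 a q"
    and pa: "pa = coefp \<alpha>2 a p" and qa: "qa = coefp \<alpha>2 a q"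
    and xa: "xa = x_bg p q a c1"
    and z0: "z0 = z_bg p q c3 c2"
    and ya: "ya = y_bg a c3 xa z0"
  shows
    "solves_A2 P Q xa ya z0
     \<and>
     (\<forall>(f :: lat) (g :: lat) x y z.
        x = x_tr xa f \<and> z = z_tr z0 f g \<and> y = y_tr xa ya f g \<longrightarrow>
          (\<forall>\<xi>. f \<xi> \<noteq> 0 \<and> til f \<xi> \<noteq> 0 \<longrightarrow>
             A1 x y z \<xi> = til xa \<xi> * B1 p a f g \<xi> / (f \<xi> * til f \<xi>))
        \<and> (\<forall>\<xi>. f \<xi> \<noteq> 0 \<and> hat f \<xi> \<noteq> 0 \<longrightarrow>
             A2 x y z \<xi> = hat xa \<xi> * B2 q a f g \<xi> / (f \<xi> * hat f \<xi>))
        \<and> (\<forall>\<xi>. f \<xi> \<noteq> 0 \<and> til f \<xi> \<noteq> 0 \<and> hat f \<xi> \<noteq> 0 \<and> hat (til f) \<xi> \<noteq> 0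
               \<and> til z \<xi> \<noteq> hat z \<xi> \<longrightarrow>
             A3 P Q x y z \<xi> = xa \<xi> *
               ((B3 p q f g \<xi> * B4 \<alpha>2 p q a f g \<xi>
                 + (p - q) * f \<xi> * hat (til f) \<xi> * B4 \<alpha>2 p q a f g \<xi>
                 + (pa * hat f \<xi> * til (und f) \<xi> - qa * til f \<xi> * hat (und f) \<xi>)
                     * B3 p q f g \<xi>)
                / ((p - q) * f \<xi> * til f \<xi> * hat f \<xi> * hat (til f) \<xi> * (til z \<xi> - hat z \<xi>))))
        \<and> ((\<forall>\<xi>. f \<xi> \<noteq> 0 \<and> til z \<xi> \<noteq> hat z \<xi>) \<and> solves_bilinear \<alpha>2 p q a f g \<longrightarrow>
             solves_A2 P Q x y z))
     \<and>
     (\<forall>(N :: nat) b (k :: nat \<Rightarrow> complex) (\<omega> :: nat \<Rightarrow> complex \<Rightarrow> complex)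
         (\<rho> :: nat \<Rightarrow> nat \<Rightarrow> complex).
        N \<ge> 1
        \<and> (\<forall>j\<in>{1..N}. omega_roots \<alpha>2 \<omega> (k j))
        \<and> (\<forall>j\<in>{1..N}. \<forall>s\<in>{0..2}.
             p \<noteq> \<omega> s (k j) \<and> q \<noteq> \<omega> s (k j) \<and> a \<noteq> \<omega> s (k j)) \<longrightarrow>
        solves_bilinear \<alpha>2 p q a
          (casoratian (psi p q a b \<omega> k \<rho>) [0..<N])
          (casoratian (psi p q a b \<omega> k \<rho>) ([0..<N - 1] @ [N])))"
proof (intro conjI allI impI)
  show "solves_A2 P Q xa ya z0"
    unfolding P Q xa ya z0 by (rule background_solves_A2) (fact assms)+
next
  fix f g x y z and \<xi> :: "int \<times> int \<times> int \<times> int"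
  assume "x = x_tr xa f \<and> z = z_tr z0 f g \<and> y = y_tr xa ya f g" "f \<xi> \<noteq> 0 \<and> til f \<xi> \<noteq> 0"
  then show "A1 x y z \<xi> = til xa \<xi> * B1 p a f g \<xi> / (f \<xi> * til f \<xi>)"
    unfolding xa ya z0 using A1_tr \<open>p \<noteq> a\<close> by blast
next
  fix f g x y z and \<xi> :: "int \<times> int \<times> int \<times> int"
  assume "x = x_tr xa f \<and> z = z_tr z0 f g \<and> y = y_tr xa ya f g" "f \<xi> \<noteq> 0 \<and> hat f \<xi> \<noteq> 0"
  then show "A2 x y z \<xi> = hat xa \<xi> * B2 q a f g \<xi> / (f \<xi> * hat f \<xi>)"
    unfolding xa ya z0 using A2_tr \<open>q \<noteq> a\<close> by blast
next
  fix f g x y z and \<xi> :: "int \<times> int \<times> int \<times> int"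
  assume xyz: "x = x_tr xa f \<and> z = z_tr z0 f g \<and> y = y_tr xa ya f g"
    and ne: "f \<xi> \<noteq> 0 \<and> til f \<xi> \<noteq> 0 \<and> hat f \<xi> \<noteq> 0 \<and> hat (til f) \<xi> \<noteq> 0 \<and> til z \<xi> \<noteq> hat z \<xi>"
  have x: "x = x_tr (x_bg p q a c1) f" and z: "z = z_tr (z_bg p q c3 c2) f g"
    and y: "y = y_tr (x_bg p q a c1) (y_bg a c3 (x_bg p q a c1) (z_bg p q c3 c2)) f g"
    using xyz unfolding xa ya z0 by blast+
  show "A3 P Q x y z \<xi> = xa \<xi> *
      ((B3 p q f g \<xi> * B4 \<alpha>2 p q a f g \<xi>
        + (p - q) * f \<xi> * hat (til f) \<xi> * B4 \<alpha>2 p q a f g \<xi>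
        + (pa * hat f \<xi> * til (und f) \<xi> - qa * til f \<xi> * hat (und f) \<xi>) * B3 p q f g \<xi>)
       / ((p - q) * f \<xi> * til f \<xi> * hat f \<xi> * hat (til f) \<xi> * (til z \<xi> - hat z \<xi>)))"
    unfolding P Q pa qa xa x y by (rule A3_tr) (use assms(1-3) c3 z ne in auto)
next
  fix f g x y z
  assume xyz: "x = x_tr xa f \<and> z = z_tr z0 f g \<and> y = y_tr xa ya f g"
    and sol: "(\<forall>\<xi>. f \<xi> \<noteq> 0 \<and> til z \<xi> \<noteq> hat z \<xi>) \<and> solves_bilinear \<alpha>2 p q a f g"
  have x: "x = x_tr (x_bg p q a c1) f" and z: "z = z_tr (z_bg p q c3 c2) f g"
    and y: "y = y_tr (x_bg p q a c1) (y_bg a c3 (x_bg p q a c1) (z_bg p q c3 c2)) f g"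
    using xyz unfolding xa ya z0 by blast+
  show "solves_A2 P Q x y z"
    unfolding P Q x y by (rule bilinear_solves_A2) (use assms(1-3) c3 z sol in auto)
next
  fix N b k \<omega> \<rho>
  assume "N \<ge> (1 :: nat) \<and> (\<forall>j\<in>{1..N}. omega_roots \<alpha>2 \<omega> (k j))
      \<and> (\<forall>j\<in>{1..N}. \<forall>s\<in>{0..2}. p \<noteq> \<omega> s (k j) \<and> q \<noteq> \<omega> s (k j) \<and> a \<noteq> \<omega> s (k j))"
  then show "solves_bilinear \<alpha>2 p q a
      (casoratian (psi p q a b \<omega> k \<rho>) [0..<N])
      (casoratian (psi p q a b \<omega> k \<rho>) ([0..<N - 1] @ [N]))"
    using casoratian_solves_bilinear[OF \<open>p \<noteq> a\<close> \<open>q \<noteq> a\<close>] by blast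
qed

end
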